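(* Let $X \in \{\mathrm{LD}, \mathrm{LTD}\}$, let $G$ be an X-admissible graph of order $n$, and let $k = \lfloor \log_2 n \rfloor \ge 2$. Then $\gamma^{X}(G) = k$ if and only if $G$ can be obtained (up to isomorphism) from some graph $G^L(k) = (C \cup (V\setminus C), E)$ for which $G^L(k)[C]$ is X-admissible, by removing up to $k-1$ vertices of $V \setminus C$.
   Context: Graphs are finite, simple and undirected. For a graph $G=(V,E)$ and $v\in V$, $N(v)$ is the open neighborhood and $N[v]=N(v)\cup\{v\}$ the closed neighborhood; $G[C]$ is the subgraph induced by $C$. A set $C\subseteq V$ is dominating (resp. total-dominating) if $N[v]\cap C\neq\emptyset$ (resp. $N(v)\cap C\ne\emptyset$) for all $v\in V$. A set $C$ is location-separating if $N(u)\cap C\neq N(v)\cap C$ for all distinct $u,v\in V\setminus C$. An LD-code (resp. LTD-code) is a set that is location-separating and dominating (resp. total-dominating). A graph is X-admissible if it has an X-code (every graph is LD-admissible; a graph is LTD-admissible iff it has no isolated vertex); $\gamma^{X}(G)$ is the minimum cardinality of an X-code of $G$. For $k\ge 2$, $G^L(k)$ denotes any graph with vertex set $V$ and a subset $C\subseteq V$ such that $|C|=k$ and $V\setminus C$ consists of exactly one vertex $v_{C'}$ with $N(v_{C'})\cap C=C'$ for each non-empty subset $C'\subseteq C$; there is no condition on the edges inside $C$ or inside $V\setminus C$. *)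

theory Defs
  imports Complex_Main "Graph_Theory.Graph_Theory"
begin

text \<open>
  A finite simple undirected graph is a digraph satisfying the locale \<^locale>\<open>graph\<close>:
  finite, loop-free, without parallel arcs, and symmetric. Each undirected edge \<open>uv\<close>
  is represented by one arc from \<open>u\<close> to \<open>v\<close> and one from \<open>v\<close> to \<open>u\<close>.
\<close>

definition open_nbhd :: "('a, 'b) pre_digraph \<Rightarrow> 'a \<Rightarrow> 'a set" where
  "open_nbhd G v = {u. v \<rightarrow>\<^bsub>G\<^esub> u}"

definition closed_nbhd :: "('a, 'b) pre_digraph \<Rightarrow> 'a \<Rightarrow> 'a set" where
  "closed_nbhd G v = insert v (open_nbhd G v)"

definition dominating :: "('a, 'b) pre_digraph \<Rightarrow> 'a set \<Rightarrow> bool" where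
  "dominating G C \<longleftrightarrow> C \<subseteq> verts G \<and> (\<forall>v\<in>verts G. closed_nbhd G v \<inter> C \<noteq> {})"

definition total_dominating :: "('a, 'b) pre_digraph \<Rightarrow> 'a set \<Rightarrow> bool" where
  "total_dominating G C \<longleftrightarrow> C \<subseteq> verts G \<and> (\<forall>v\<in>verts G. open_nbhd G v \<inter> C \<noteq> {})"

definition location_separating :: "('a, 'b) pre_digraph \<Rightarrow> 'a set \<Rightarrow> bool" where
  "location_separating G C \<longleftrightarrow> C \<subseteq> verts G \<and>
     (\<forall>u\<in>verts G - C. \<forall>v\<in>verts G - C. u \<noteq> v \<longrightarrow> open_nbhd G u \<inter> C \<noteq> open_nbhd G v \<inter> C)"

datatype code_kind = LD | LTD

fun is_code :: "code_kind \<Rightarrow> ('a, 'b) pre_digraph \<Rightarrow> 'a set \<Rightarrow> bool" where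
  "is_code LD G C \<longleftrightarrow> location_separating G C \<and> dominating G C"
| "is_code LTD G C \<longleftrightarrow> location_separating G C \<and> total_dominating G C"

definition admissible :: "code_kind \<Rightarrow> ('a, 'b) pre_digraph \<Rightarrow> bool" where
  "admissible X G \<longleftrightarrow> (\<exists>C. is_code X G C)"

text \<open>The code number \<open>\<gamma>\<^sup>X(G)\<close>; only meaningful for finite \<open>X\<close>-admissible graphs.\<close>

definition code_number :: "code_kind \<Rightarrow> ('a, 'b) pre_digraph \<Rightarrow> nat" where
  "code_number X G = (LEAST m. \<exists>C. is_code X G C \<and> card C = m)"

text \<open>
  \<open>is_GL k H C\<close> says that \<open>H\<close>, with distinguished set \<open>C\<close>, is one of the graphs \<open>G\<^sup>L(k)\<close>.
  The last conjunct says that outside \<open>C\<close> there are no vertices other than the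
  \<open>v\<^bsub>C'\<^esub>\<close> for non-empty \<open>C' \<subseteq> C\<close>.
\<close>

definition is_GL :: "nat \<Rightarrow> ('a, 'b) pre_digraph \<Rightarrow> 'a set \<Rightarrow> bool" where
  "is_GL k H C \<longleftrightarrow> graph H \<and> C \<subseteq> verts H \<and> card C = k \<and>
     (\<forall>C'. C' \<subseteq> C \<and> C' \<noteq> {} \<longrightarrow> (\<exists>!v. v \<in> verts H - C \<and> open_nbhd H v \<inter> C = C')) \<and>
     (\<forall>v\<in>verts H - C. open_nbhd H v \<inter> C \<noteq> {})"

end

theory Submission
  imports Defs
begin

text \<open>
  The traces \<open>N(v) \<inter> C\<close> on an \<open>X\<close>-code \<open>C\<close> embed \<open>V - C\<close> into the \<open>2\<^bsup>card C\<^esup> - 1\<close> non-empty subsets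
  of \<open>C\<close>, so \<open>n \<le> card C + 2\<^bsup>card C\<^esup> - 1\<close>; hence every code has at least \<open>\<lfloor>log\<^sub>2 n\<rfloor>\<close> elements.
  If a code of size \<open>k = \<lfloor>log\<^sub>2 n\<rfloor>\<close> exists, at most \<open>k - 1\<close> non-empty subsets of \<open>C\<close> are missing
  as traces, and adjoining one new vertex for each missing subset yields a graph \<open>G\<^sup>L(k)\<close>.
\<close>

section \<open>Codes, G^L(k) and admissibility in terms of traces\<close>

abbreviation trace_on :: "('a, 'b) pre_digraph \<Rightarrow> 'a set \<Rightarrow> 'a \<Rightarrow> 'a set" where
  "trace_on G C v \<equiv> open_nbhd G v \<inter> C"

text \<open>Outside C, closed and open neighborhoods meet C in the same set, so both kinds of
  domination demand a non-empty trace there. A vertex of C lies in its own closed neighborhood;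
  hence only LTD constrains the members of C.\<close>

lemma is_code_iff_trace:
  "is_code X G C \<longleftrightarrow> C \<subseteq> verts G \<and> inj_on (trace_on G C) (verts G - C) \<and>
     (\<forall>v\<in>verts G - C. trace_on G C v \<noteq> {}) \<and> (X = LTD \<longrightarrow> (\<forall>c\<in>C. trace_on G C c \<noteq> {}))"
  by (cases X)
    (auto simp: location_separating_def dominating_def total_dominating_def closed_nbhd_def
      inj_on_def)

text \<open>Unique existence gives surjectivity and, applied to the trace of a given vertex,
  injectivity. In this form, deleting vertices restricts an injection and adjoining vertices glues
  two bijections.\<close>

lemma is_GL_iff_bij_betw:
  "is_GL k H C \<longleftrightarrow> graph H \<and> C \<subseteq> verts H \<and> card C = k \<and>
     bij_betw (trace_on H C) (verts H - C) (Pow C - {{}})"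
proof -
  have "bij_betw (trace_on H C) (verts H - C) (Pow C - {{}}) \<longleftrightarrow>
     (\<forall>C'. C' \<subseteq> C \<and> C' \<noteq> {} \<longrightarrow> (\<exists>!v. v \<in> verts H - C \<and> trace_on H C v = C')) \<and>
     (\<forall>v\<in>verts H - C. trace_on H C v \<noteq> {})" (is "?L \<longleftrightarrow> ?R1 \<and> ?R2")
  proof
    assume L: ?L
    then have ?R2
      unfolding bij_betw_def by blast
    moreover have ?R1
    proof (intro allI impI ex_ex1I)
      fix C' assume "C' \<subseteq> C \<and> C' \<noteq> {}"
      then have "C' \<in> trace_on H C ` (verts H - C)"
        using L by (auto simp: bij_betw_def)
      then show "\<exists>v. v \<in> verts H - C \<and> trace_on H C v = C'"
        by blast
    next
      fix C' u v assume "u \<in> verts H - C \<and> trace_on H C u = C'" "v \<in> verts H - C \<and> trace_on H C v = C'"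
      then show "u = v"
        using L by (auto simp: bij_betw_def dest: inj_onD)
    qed
    ultimately show "?R1 \<and> ?R2"
      by (rule conjI[rotated])
  next
    assume R: "?R1 \<and> ?R2"
    have "inj_on (trace_on H C) (verts H - C)"
    proof (rule inj_onI)
      fix u v assume "u \<in> verts H - C" "v \<in> verts H - C" "trace_on H C u = trace_on H C v"
      moreover from this have "\<exists>!w. w \<in> verts H - C \<and> trace_on H C w = trace_on H C u"
        using R by simp
      ultimately show "u = v"
        by auto
    qed
    moreover have "trace_on H C ` (verts H - C) = Pow C - {{}}"
    proof
      show "Pow C - {{}} \<subseteq> trace_on H C ` (verts H - C)"
      proof
        fix C' assume "C' \<in> Pow C - {{}}"
        then have "\<exists>!v. v \<in> verts H - C \<and> trace_on H C v = C'"
          using R by simp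
        then show "C' \<in> trace_on H C ` (verts H - C)"
          by blast
      qed
    qed (use R in blast)
    ultimately show ?L
      unfolding bij_betw_def ..
  qed
  then show ?thesis
    by (simp only: is_GL_def)
qed

lemma open_nbhd_induce_subgraph:
  assumes "v \<in> S"
  shows "open_nbhd (G \<restriction> S) v = open_nbhd G v \<inter> S"
  using assms by (auto simp: open_nbhd_def arcs_ends_conv)

text \<open>In the graph induced on C, the whole vertex set C has nothing outside it to separate or
  dominate, so it is a code unless X is LTD and some vertex is isolated. The right-hand side is
  exactly the clause about members of C in \<open>is_code_iff_trace\<close>.\<close>

lemma admissible_induce_subgraph_iff:
  "admissible X (G \<restriction> C) \<longleftrightarrow> (X = LTD \<longrightarrow> (\<forall>c\<in>C. trace_on G C c \<noteq> {}))"
proof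
  assume "admissible X (G \<restriction> C)"
  then obtain D where D: "is_code X (G \<restriction> C) D"
    unfolding admissible_def ..
  show "X = LTD \<longrightarrow> (\<forall>c\<in>C. trace_on G C c \<noteq> {})"
    using D by (fastforce simp: total_dominating_def open_nbhd_induce_subgraph)
next
  assume "X = LTD \<longrightarrow> (\<forall>c\<in>C. trace_on G C c \<noteq> {})"
  then have "is_code X (G \<restriction> C) C"
    unfolding is_code_iff_trace by (simp add: open_nbhd_induce_subgraph)
  then show "admissible X (G \<restriction> C)"
    unfolding admissible_def by blast
qed

section \<open>Counting bounds and the code number\<close>

lemma is_code_card_le:
  assumes "finite (verts G)" "is_code X G C"
  shows "card (verts G) \<le> card C + (2 ^ card C - 1)"
proof -
  have C: "C \<subseteq> verts G" "finite C" "inj_on (trace_on G C) (verts G - C)"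
    and sub: "trace_on G C ` (verts G - C) \<subseteq> Pow C - {{}}"
    using assms by (auto simp: is_code_iff_trace intro: finite_subset)
  have "card (verts G - C) = card (trace_on G C ` (verts G - C))"
    using C by (simp add: card_image)
  also have "\<dots> \<le> card (Pow C - {{}})"
    using sub C by (intro card_mono) auto
  also have "\<dots> = 2 ^ card C - 1"
    using C by (simp add: card_Pow)
  finally show ?thesis
    unfolding card_Diff_subset[OF C(2,1)] by linarith
qed

text \<open>If m = \<open>card C\<close> were below k, the preceding bound would give n \<le> m +
  2^m - 1 < 2 * 2^m \<le> 2^k.\<close>

lemma is_code_card_ge:
  assumes "finite (verts G)" "is_code X G C" "2 ^ k \<le> card (verts G)"
  shows "k \<le> card C"
proof (rule ccontr)
  assume "\<not> k \<le> card C"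
  then have "2 * 2 ^ card C \<le> (2::nat) ^ k"
    by (metis not_less_eq_eq power_Suc power_increasing one_le_numeral)
  moreover have "card C < 2 ^ card C"
    by simp
  moreover have "card (verts G) \<le> card C + (2 ^ card C - 1)"
    using assms by (intro is_code_card_le)
  ultimately show False
    using assms(3) by linarith
qed

text \<open>Admissibility ensures that the \<open>LEAST\<close> is attained by some code, and
  \<open>is_code_card_ge\<close> makes k a lower bound for all code sizes.\<close>

lemma code_number_eq_iff:
  assumes "finite (verts G)" "admissible X G" "2 ^ k \<le> card (verts G)"
  shows "code_number X G = k \<longleftrightarrow> (\<exists>C. is_code X G C \<and> card C = k)"
proof
  have "\<exists>m C. is_code X G C \<and> card C = m"
    using assms(2) by (auto simp: admissible_def)
  then have "\<exists>C. is_code X G C \<and> card C = code_number X G"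
    unfolding code_number_def by (rule LeastI_ex)
  moreover assume "code_number X G = k"
  ultimately show "\<exists>C. is_code X G C \<and> card C = k"
    by simp
next
  assume "\<exists>C. is_code X G C \<and> card C = k"
  then show "code_number X G = k"
    unfolding code_number_def using assms(1,3) by (intro Least_equality) (auto intro: is_code_card_ge)
qed

section \<open>Transport of codes along isomorphisms and vertex deletions\<close>

context wf_digraph
begin

lemma open_nbhd_subset: "open_nbhd G v \<subseteq> verts G"
  by (auto simp: open_nbhd_def dest: adj_in_verts)

lemma open_nbhd_app_iso:
  assumes "digraph_isomorphism hom" "v \<in> verts G"
  shows "open_nbhd (app_iso hom G) (iso_verts hom v) = iso_verts hom ` open_nbhd G v"
proof -
  have "iso_verts hom v = iso_verts hom u \<longleftrightarrow> v = u" if "u \<rightarrow> w" for u w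
    using iso_verts_eq_iff[OF assms adj_in_verts(1)[OF that]] .
  then show ?thesis
    unfolding open_nbhd_def arcs_ends_app_iso_eq[OF assms(1)] by (auto intro: rev_image_eqI)
qed

text \<open>Codes and neighborhoods lie in \<open>verts G\<close>, where
  \<open>iso_verts hom\<close> is injective. Images therefore commute with intersections and
  differences, and traces are carried to traces.\<close>

lemma is_code_app_iso:
  assumes hom: "digraph_isomorphism hom" and C: "is_code X G C"
  shows "is_code X (app_iso hom G) (iso_verts hom ` C)"
proof -
  have inj: "inj_on (iso_verts hom) (verts G)"
    using hom by (rule digraph_isomorphism_inj_on_verts)
  have sub: "C \<subseteq> verts G"
    using C by (simp add: is_code_iff_trace)
  have tr: "trace_on (app_iso hom G) (iso_verts hom ` C) (iso_verts hom v) =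
      iso_verts hom ` trace_on G C v" if "v \<in> verts G" for v
    using inj_on_image_Int[OF inj open_nbhd_subset sub] hom that
    by (simp add: open_nbhd_app_iso)
  have diff: "verts (app_iso hom G) - iso_verts hom ` C = iso_verts hom ` (verts G - C)"
    using inj_on_image_set_diff[OF inj _ sub] by simp
  have "u = v" if uv: "u \<in> verts G - C" "v \<in> verts G - C"
    and eq: "iso_verts hom ` trace_on G C u = iso_verts hom ` trace_on G C v" for u v
  proof -
    have "trace_on G C u = trace_on G C v"
      using eq sub by (subst (asm) inj_on_image_eq_iff[OF inj]) auto
    then show ?thesis
      using C uv by (auto simp: is_code_iff_trace dest: inj_onD)
  qed
  then show ?thesis
    unfolding is_code_iff_trace diff using C sub
    by (auto simp: inj_on_def tr is_code_iff_trace subset_iff)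
qed

end

lemma digraph_iso_is_code:
  assumes "wf_digraph G" "digraph_iso G H" "is_code X G C"
  obtains D where "is_code X H D" "card D = card C"
proof -
  obtain hom where hom: "pre_digraph.digraph_isomorphism G hom" "H = app_iso hom G"
    using assms(2) by (auto simp: digraph_iso_def)
  have "inj_on (iso_verts hom) C"
    using pre_digraph.digraph_isomorphism_inj_on_verts[OF hom(1)] assms(3)
    by (auto simp: is_code_iff_trace intro: inj_on_subset)
  then show ?thesis
    using that wf_digraph.is_code_app_iso[OF assms(1) hom(1) assms(3)] hom(2)
    by (simp add: card_image)
qed

text \<open>Removing vertices outside C leaves all remaining traces on C unchanged, so they stay
  distinct and non-empty. Admissibility of the graph induced on C supplies the condition on members
  of C.\<close>

lemma is_GL_is_code_induce_subgraph:
  assumes "is_GL k H C" "admissible X (H \<restriction> C)" "R \<subseteq> verts H - C"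
  shows "is_code X (H \<restriction> (verts H - R)) C"
proof -
  have GL: "C \<subseteq> verts H" "bij_betw (trace_on H C) (verts H - C) (Pow C - {{}})"
    using assms(1) by (auto simp: is_GL_iff_bij_betw)
  then have C: "C \<subseteq> verts H - R"
    using assms(3) by auto
  have tr: "trace_on (H \<restriction> (verts H - R)) C v = trace_on H C v" if "v \<in> verts H - R" for v
    using C that by (auto simp: open_nbhd_induce_subgraph)
  have "inj_on (trace_on H C) (verts H - R - C)"
    using GL(2) by (auto simp: bij_betw_def intro: inj_on_subset)
  then have "inj_on (trace_on (H \<restriction> (verts H - R)) C) (verts H - R - C)"
    using tr by (simp add: inj_on_def)
  moreover have "trace_on H C v \<noteq> {}" if "v \<in> verts H - C" for v
    using bij_betwE[OF GL(2)] that by blast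
  ultimately show ?thesis
    using C assms(2) tr by (auto simp: is_code_iff_trace admissible_induce_subgraph_iff subset_iff)
qed

section \<open>Adjoining one vertex for each missing trace\<close>

text \<open>The vertices get a fresh type because \<open>'a\<close> may have no spare elements. Arcs
  are their own pairs of ends, which excludes parallel arcs. With disjoint images of
  \<open>f\<close> and \<open>g\<close>, the new vertices are pairwise non-adjacent, as G^L(k)
  permits.\<close>

definition extension ::
  "('a, 'b) pre_digraph \<Rightarrow> 'a set set \<Rightarrow> ('a \<Rightarrow> 'c) \<Rightarrow> ('a set \<Rightarrow> 'c) \<Rightarrow> ('c, 'c \<times> 'c) pre_digraph" where
  "extension G M f g =
    \<lparr> verts = f ` verts G \<union> g ` M,
      arcs = map_prod f f ` arcs_ends G \<union> {(f c, g S) | c S. S \<in> M \<and> c \<in> S}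
        \<union> {(g S, f c) | c S. S \<in> M \<and> c \<in> S},
      tail = fst, head = snd \<rparr>"

locale graph_extension = graph G for G :: "('a, 'b) pre_digraph" +
  fixes M :: "'a set set" and f :: "'a \<Rightarrow> 'c" and g :: "'a set \<Rightarrow> 'c"
  assumes M_sub: "M \<subseteq> Pow (verts G)"
    and inj_f: "inj_on f (verts G)"
    and inj_g: "inj_on g M"
    and disj: "f ` verts G \<inter> g ` M = {}"
begin

abbreviation "H \<equiv> extension G M f g"

lemma arcs_ends_extension: "arcs_ends H = arcs H"
  by (simp add: arcs_ends_conv extension_def)

lemma f_neq_g:
  assumes "u \<in> verts G" "S \<in> M"
  shows "f u \<noteq> g S" "g S \<noteq> f u"
  using disj assms by blast+

lemma f_eq_iff: "u \<in> verts G \<Longrightarrow> v \<in> verts G \<Longrightarrow> f u = f v \<longleftrightarrow> u = v"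
  using inj_f by (auto dest: inj_onD)

lemma g_eq_iff: "S \<in> M \<Longrightarrow> T \<in> M \<Longrightarrow> g S = g T \<longleftrightarrow> S = T"
  using inj_g by (auto dest: inj_onD)

lemma finite_M: "finite M"
  using M_sub by (rule finite_subset) simp

lemma graph_H: "graph H"
proof -
  have "arcs H \<subseteq> verts H \<times> verts H"
    using M_sub by (auto simp: extension_def dest: adj_in_verts)
  moreover have fin: "finite (verts H)"
    using finite_M by (simp add: extension_def)
  ultimately have "finite (arcs H)"
    by (meson finite_SigmaI finite_subset)
  moreover have "sym (arcs_ends H)"
    unfolding arcs_ends_extension
    using graph_symmetric by (force intro!: symI simp: extension_def)
  \<comment> \<open>Copied arcs stay loop-free by injectivity of \<open>f\<close>; every other arc
    joins the two disjoint images.\<close>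
  moreover have "fst e \<noteq> snd e" if "e \<in> arcs H" for e
  proof -
    from that consider u v where "u \<rightarrow>\<^bsub>G\<^esub> v" "e = (f u, f v)"
      | c S where "S \<in> M" "c \<in> S" "e = (f c, g S) \<or> e = (g S, f c)"
      by (auto simp: extension_def)
    then show ?thesis
    proof cases
      case 1
      then have "u \<noteq> v" "u \<in> verts G" "v \<in> verts G"
        by (auto dest: adj_in_verts adj_not_same)
      with 1 show ?thesis
        by (simp add: f_eq_iff)
    next
      case 2
      then have "c \<in> verts G"
        using M_sub by blast
      with 2 show ?thesis
        using f_neq_g by auto
    qed
  qed
  moreover have "tail H = fst" "head H = snd"
    by (simp_all add: extension_def)
  ultimately show ?thesis
    using fin \<open>arcs H \<subseteq> verts H \<times> verts H\<close>
    by unfold_locales (simp_all add: symmetric_def arc_to_ends_def subset_eq mem_Times_iff)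
qed

lemma open_nbhd_f:
  assumes "v \<in> verts G"
  shows "open_nbhd H (f v) = f ` open_nbhd G v \<union> g ` {S \<in> M. v \<in> S}"
proof -
  have "f v = f c \<longleftrightarrow> v = c" if "S \<in> M" "c \<in> S" for c S
    using assms that M_sub f_eq_iff by blast
  moreover have "f v = f c \<longleftrightarrow> v = c" if "c \<rightarrow>\<^bsub>G\<^esub> d" for c d
    using assms that adj_in_verts f_eq_iff by blast
  ultimately show ?thesis
    unfolding open_nbhd_def arcs_ends_extension using assms
    by (auto simp: extension_def f_neq_g; force)
qed

lemma open_nbhd_g:
  assumes "S \<in> M"
  shows "open_nbhd H (g S) = f ` S"
proof -
  have "(g S, w) \<notin> map_prod f f ` arcs_ends G" for w
    using assms f_neq_g by (auto dest: adj_in_verts)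
  moreover have "(g S, w) \<notin> {(f c, g T) | c T. T \<in> M \<and> c \<in> T}" for w
    using assms M_sub f_neq_g by blast
  ultimately have "(g S, w) \<in> arcs H \<longleftrightarrow> (g S, w) \<in> {(g T, f c) | c T. T \<in> M \<and> c \<in> T}" for w
    by (simp only: extension_def pre_digraph.simps Un_iff simp_thms)
  then show ?thesis
    unfolding open_nbhd_def arcs_ends_extension using assms by (auto simp: g_eq_iff)
qed

text \<open>The neighbors gained by an old vertex all lie in \<open>g\<close>
  M\<open>, which misses\<close>f \<open>C\<close>.\<close>

lemma trace_on_f:
  assumes "C \<subseteq> verts G" "v \<in> verts G"
  shows "trace_on H (f ` C) (f v) = f ` trace_on G C v"
proof -
  have "g ` {S \<in> M. v \<in> S} \<inter> f ` C = {}"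
    using disj assms(1) by blast
  then show ?thesis
    using inj_on_image_Int[OF inj_f open_nbhd_subset assms(1)] assms(2)
    by (simp add: open_nbhd_f Int_Un_distrib2)
qed

lemma trace_on_g:
  assumes "S \<in> M" "S \<subseteq> C"
  shows "trace_on H (f ` C) (g S) = f ` S"
  using assms by (auto simp: open_nbhd_g)

lemma digraph_iso_induce: "digraph_iso G (H \<restriction> (f ` verts G))"
  unfolding digraph_iso_def
proof (intro exI conjI)
  \<comment> \<open>Each arc goes to its renamed pair of ends; this is injective on arcs because
    \<open>G\<close> has no parallel arcs.\<close>
  let ?hom = "\<lparr> iso_verts = f, iso_arcs = map_prod f f \<circ> arc_to_ends G, iso_head = snd, iso_tail = fst \<rparr>"
  have "inj_on (map_prod f f) (arc_to_ends G ` arcs G)"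
    using map_prod_inj_on[OF inj_f inj_f] by (rule inj_on_subset) (auto simp: arc_to_ends_def)
  then show "pre_digraph.digraph_isomorphism G ?hom"
    unfolding digraph_isomorphism_def
    using inj_f wf_digraph inj_on_arc_to_ends by (auto simp: arc_to_ends_def intro: comp_inj_on)
  have "{e \<in> arcs H. fst e \<in> f ` verts G \<and> snd e \<in> f ` verts G} = map_prod f f ` arcs_ends G"
    by (auto simp: extension_def f_neq_g dest: adj_in_verts)
  then show "H \<restriction> (f ` verts G) = app_iso ?hom G"
    unfolding induce_subgraph_def app_iso_def
    by (simp add: extension_def arcs_ends_def image_comp)
qed

text \<open>Old vertices outside C realise the traces in \<open>?U\<close> and new ones realise the
  complementary family \<open>M\<close>. These are two bijections with disjoint domains and ranges,
  so they combine into one onto all non-empty subsets.\<close>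

lemma is_GL_extension:
  assumes C: "is_code X G C" and M: "M = Pow C - {{}} - trace_on G C ` (verts G - C)"
  shows "is_GL (card C) H (f ` C)"
proof -
  have sub: "C \<subseteq> verts G" and injC: "inj_on f C" and inj: "inj_on (trace_on G C) (verts G - C)"
    using C inj_f by (auto simp: is_code_iff_trace intro: inj_on_subset)
  have tr: "\<forall>v\<in>verts G - C. trace_on H (f ` C) (f v) = f ` trace_on G C v"
    "\<forall>S\<in>M. trace_on H (f ` C) (g S) = f ` S"
    using sub trace_on_f trace_on_g M by auto
  let ?U = "trace_on G C ` (verts G - C)"
  have U: "?U \<subseteq> Pow C - {{}}"
    using C by (auto simp: is_code_iff_trace)
  \<comment> \<open>Lifting \<open>f\<close> to sets injectively keeps \<open>?U\<close> and
    \<open>M\<close> disjoint after renaming.\<close>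
  have injP: "inj_on ((`) f) (Pow C)"
    using injC by (rule inj_on_image_Pow)
  have V: "verts H - f ` C = f ` (verts G - C) \<union> g ` M"
    using disj sub by (auto simp: extension_def f_eq_iff subset_iff)
  have "bij_betw (trace_on H (f ` C)) (f ` (verts G - C)) ((`) f ` ?U)"
  proof -
    have "trace_on H (f ` C) ` f ` (verts G - C) = (`) f ` ?U"
      using tr(1) unfolding image_image by (intro image_cong) auto
    moreover have "inj_on ((`) f \<circ> trace_on G C) (verts G - C)"
      using inj injP U by (intro comp_inj_on) (auto intro: inj_on_subset)
    then have "inj_on (trace_on H (f ` C)) (f ` (verts G - C))"
      using tr(1) unfolding inj_on_def by auto
    ultimately show ?thesis
      by (simp add: bij_betw_def)
  qed
  moreover have "bij_betw (trace_on H (f ` C)) (g ` M) ((`) f ` M)"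
  proof -
    have "trace_on H (f ` C) ` g ` M = (`) f ` M"
      using tr(2) unfolding image_image by (intro image_cong) auto
    moreover have "inj_on ((`) f) M"
      using injP by (rule inj_on_subset) (auto simp: M)
    then have "inj_on (trace_on H (f ` C)) (g ` M)"
      using tr(2) unfolding inj_on_def by auto
    ultimately show ?thesis
      by (simp add: bij_betw_def)
  qed
  moreover have "(`) f ` ?U \<inter> (`) f ` M = {}"
  proof -
    have "(`) f ` (?U \<inter> M) = (`) f ` ?U \<inter> (`) f ` M"
      using U by (intro inj_on_image_Int[OF injP]) (auto simp: M)
    moreover have "?U \<inter> M = {}"
      by (auto simp: M)
    ultimately show ?thesis
      by simp
  qed
  ultimately have "bij_betw (trace_on H (f ` C)) (verts H - f ` C) ((`) f ` ?U \<union> (`) f ` M)"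
    unfolding V by (rule bij_betw_combine)
  moreover have "(`) f ` ?U \<union> (`) f ` M = Pow (f ` C) - {{}}"
  proof -
    have "?U \<union> M = Pow C - {{}}"
      using U unfolding M by blast
    then have "(`) f ` ?U \<union> (`) f ` M = (`) f ` (Pow C - {{}})"
      by (metis image_Un)
    also have "\<dots> = Pow (f ` C) - {{}}"
      using inj_on_image_set_diff[OF injP, of "Pow C" "{{}}"] image_Pow_surj[of f C] by auto
    finally show ?thesis .
  qed
  ultimately show ?thesis
    using sub injC graph_H by (auto simp: is_GL_iff_bij_betw card_image extension_def)
qed

end

lemma is_code_obtain_GL:
  assumes "graph G" and C: "is_code X G C" and card: "2 ^ card C \<le> card (verts G)"
  obtains H :: "(nat, nat \<times> nat) pre_digraph" and C' R
  where "is_GL (card C) H C'" "admissible X (H \<restriction> C')" "R \<subseteq> verts H - C'"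
    "card R \<le> card C - 1" "digraph_iso G (H \<restriction> (verts H - R))"
proof -
  interpret graph G by fact
  let ?U = "trace_on G C ` (verts G - C)"
  define M where "M = Pow C - {{}} - ?U"
  have sub: "C \<subseteq> verts G" and inj: "inj_on (trace_on G C) (verts G - C)"
    and U: "?U \<subseteq> Pow C - {{}}"
    using C by (auto simp: is_code_iff_trace)
  have finC: "finite C"
    using sub by (rule finite_subset) simp
  have finM: "finite M"
    using finC by (simp add: M_def)
  have cardM: "card M \<le> card C - 1"
  proof -
    have "card M = card (Pow C - {{}}) - card ?U"
      unfolding M_def using U finC by (intro card_Diff_subset) (auto intro: finite_subset)
    \<comment> \<open>With m = \<open>card C\<close> and n = \<open>card (verts G)\<close>, n \<ge>
      2^m bounds this number by m - 1.\<close>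
    also have "\<dots> = 2 ^ card C - 1 - (card (verts G) - card C)"
      using finC inj sub by (simp add: card_image card_Pow card_Diff_subset)
    finally show ?thesis
      using card by linarith
  qed
  \<comment> \<open>Numbering the disjoint sum of old vertices and missing subsets injectively makes
    \<open>e \<circ> Inl\<close> and \<open>e \<circ> Inr\<close> injective there with disjoint
    images.\<close>
  obtain e :: "'a + 'a set \<Rightarrow> nat" where e: "inj_on e (Inl ` verts G \<union> Inr ` M)"
    using finite_imp_inj_to_nat_seg[of "Inl ` verts G \<union> Inr ` M"] finM by auto
  interpret graph_extension G M "e \<circ> Inl" "e \<circ> Inr"
  proof unfold_locales
    show "M \<subseteq> Pow (verts G)"
      using sub by (auto simp: M_def)
    show "inj_on (e \<circ> Inl) (verts G)" "inj_on (e \<circ> Inr) M"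
      by (intro comp_inj_on inj_on_subset[OF e]; simp)+
    show "(e \<circ> Inl) ` verts G \<inter> (e \<circ> Inr) ` M = {}"
    proof -
      have "e (Inl v) \<noteq> e (Inr S)" if "v \<in> verts G" "S \<in> M" for v S
        using inj_on_eq_iff[OF e, of "Inl v" "Inr S"] that by simp
      then show ?thesis
        by auto
    qed
  qed
  let ?f = "e \<circ> Inl" and ?R = "(e \<circ> Inr) ` M"
  show thesis
  proof
    show "is_GL (card C) H (?f ` C)"
      using C M_def by (rule is_GL_extension)
    show "admissible X (H \<restriction> (?f ` C))"
      unfolding admissible_induce_subgraph_iff
    proof (intro impI ballI)
      fix d assume "X = LTD" "d \<in> ?f ` C"
      then obtain c where "d = ?f c" "c \<in> C" "trace_on G C c \<noteq> {}"
        using C by (auto simp: is_code_iff_trace)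
      then show "trace_on H (?f ` C) d \<noteq> {}"
        using trace_on_f[OF sub, of c] sub by auto
    qed
    show "?R \<subseteq> verts H - ?f ` C"
      using disj sub by (auto simp: extension_def)
    show "card ?R \<le> card C - 1"
      using cardM unfolding card_image[OF inj_g] .
    \<comment> \<open>Deleting exactly the adjoined vertices recovers the copy of
      \<open>G\<close>.\<close>
    have "verts H - ?R = ?f ` verts G"
      using disj by (auto simp: extension_def)
    then show "digraph_iso G (H \<restriction> (verts H - ?R))"
      using digraph_iso_induce by simp
  qed
qed

theorem theorem2:
  fixes X :: code_kind and G :: "('a, 'b) pre_digraph" and n k :: nat
  assumes "graph G"
    and "admissible X G"
    and "n = card (verts G)"
    and "int k = \<lfloor>log 2 (real n)\<rfloor>"
    and "k \<ge> 2"
  shows "code_number X G = k \<longleftrightarrow>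
    (\<exists>(H :: (nat, nat \<times> nat) pre_digraph) C R.
       is_GL k H C \<and> admissible X (H \<restriction> C) \<and>
       R \<subseteq> verts H - C \<and> card R \<le> k - 1 \<and>
       digraph_iso G (H \<restriction> (verts H - R)))"
proof -
  interpret graph G by fact
  \<comment> \<open>In HOL \<open>log 2 0\<close> is 0, so n = 0 would force k = 0.\<close>
  have "n > 0"
    using assms(4,5) by (cases n) (auto simp: log_def)
  moreover have "real k \<le> log 2 (real n)"
    using assms(4) by linarith
  ultimately have "2 powr real k \<le> real n"
    by (simp add: le_log_iff)
  then have "2 ^ k \<le> card (verts G)"
    unfolding assms(3) by (simp add: powr_realpow numeral_power_le_of_nat_cancel_iff)
  then have number: "code_number X G = k \<longleftrightarrow> (\<exists>C. is_code X G C \<and> card C = k)"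
    using assms(2) by (intro code_number_eq_iff) auto
  show ?thesis (is "_ \<longleftrightarrow> ?R")
  proof
    assume "code_number X G = k"
    then obtain C where "is_code X G C" "card C = k"
      using number by blast
    then show ?R
      using is_code_obtain_GL[OF assms(1), of X C] \<open>2 ^ k \<le> card (verts G)\<close> by metis
  next
    assume ?R
    then obtain H :: "(nat, nat \<times> nat) pre_digraph" and C R
      where GL: "is_GL k H C" "admissible X (H \<restriction> C)" "R \<subseteq> verts H - C"
        and iso: "digraph_iso G (H \<restriction> (verts H - R))"
      by blast
    let ?K = "H \<restriction> (verts H - R)"
    have "is_code X ?K C"
      using GL by (rule is_GL_is_code_induce_subgraph)
    moreover have "wf_digraph ?K"
      using iso wf_digraphI_app_iso by (auto simp: digraph_iso_def)
    \<comment> \<open>The code was found in \<open>?K\<close>, so the isomorphism is reversed to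
      carry it back to \<open>G\<close>.\<close>
    moreover have "digraph_iso ?K G"
      using wf_digraph iso by (rule digraph_iso_swap)
    ultimately obtain D where "is_code X G D" "card D = card C"
      using digraph_iso_is_code by metis
    then show "code_number X G = k"
      using number GL(1) by (auto simp: is_GL_def)
  qed
qed

end
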